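(* Let $n\ge 1$, let $p\in[1,+\infty)$ and let $d_{\mathcal M}:\mathcal M^*_c(\mathbb R^n)\times\mathcal M^*_c(\mathbb R^n)\to[0,+\infty)$ be a distance function satisfying the following two properties: (i) there exists a function $f:\mathbb R_{>0}\to\mathbb R_{>0}$ such that $$d_{\mathcal M}(m\mu_1,m\mu_2)=f(m)\,W_p(\mu_1,\mu_2)$$ for every $m\in\mathbb R_{>0}$ and every $\mu_1,\mu_2\in\mathcal P_c(\mathbb R^n)$; (ii) $\Sigma\subseteq\mathbb R^n$ is an unbounded subset such that for every $m_0\in\mathbb R_{>0}$ there exist a radius $r>0$ and a constant $C>0$, both depending only on $m_0$, with $$\sup_{x\in\Sigma}d_{\mathcal M}(m_0\delta_x,m\delta_x)\le C$$ for every $m\in(m_0-r,m_0+r)$ (with $m>0$). Then there exists no distance function $d_{\mathcal M_0}$ defined on $\mathcal M_c(\mathbb R^n)$ which agrees with $d_{\mathcal M}$ on $\mathcal M^*_c(\mathbb R^n)$ and such that at least one of the following holds: (a) $\displaystyle\sup_{x\in\Sigma}d_{\mathcal M_0}(0,m_0\delta_x)<+\infty$ for some $m_0\in\mathbb R_{>0}$; (b) there are two different $\mu_1\neq\mu_2$ in $\mathcal P_c(\mathbb R^n)$ such that $\displaystyle\lim_{m\searrow0}d_{\mathcal M_0}(0,m\mu_i)=0$ for $i=1,2$.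
   Context: $\mathbb R_{>0}=(0,+\infty)$. $\mathcal M_c(\mathbb R^n)$ is the set of non-negative Borel measures on $\mathbb R^n$ with finite total mass and compact support (including the zero measure, denoted $0$), and $\mathcal M^*_c(\mathbb R^n)$ is the subset of those with strictly positive mass, so $\mathcal M_c(\mathbb R^n)=\{0\}\cup\mathcal M^*_c(\mathbb R^n)$. $\mathcal P_c(\mathbb R^n)$ is the set of Borel probability measures on $\mathbb R^n$ with compact support. $\delta_x$ is the Dirac delta centered at $x$. A distance function on a set is a metric in the usual sense (with finite values). $W_p$ denotes the $p$-Wasserstein distance on $\mathcal P_c(\mathbb R^n)$ with respect to the Euclidean distance: $W_p(\mu,\nu)=\left(\inf_{\pi}\int_{\mathbb R^n\times\mathbb R^n}|x-y|^p\,d\pi(x,y)\right)^{1/p}$, the infimum being over Borel probability measures $\pi$ on $\mathbb R^n\times\mathbb R^n$ with marginals $\mu$ and $\nu$. *)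

theory Defs
  imports "HOL-Probability.Probability"
begin

definition measure_support :: "'a::topological_space measure \<Rightarrow> 'a set" where
  "measure_support \<mu> = {x. \<forall>U. open U \<longrightarrow> x \<in> U \<longrightarrow> 0 < emeasure \<mu> U}"

definition Mc :: "(real ^ 'n) measure set" where
  "Mc = {\<mu>. sets \<mu> = sets borel \<and> finite_measure \<mu> \<and> compact (measure_support \<mu>)}"

definition Mc_pos :: "(real ^ 'n) measure set" where
  "Mc_pos = {\<mu> \<in> Mc. 0 < measure \<mu> (space \<mu>)}"

definition Pc :: "(real ^ 'n) measure set" where
  "Pc = {\<mu>. sets \<mu> = sets borel \<and> prob_space \<mu> \<and> compact (measure_support \<mu>)}"

definition couplings ::
  "(real ^ 'n) measure \<Rightarrow> (real ^ 'n) measure \<Rightarrow> ((real ^ 'n) \<times> (real ^ 'n)) measure set" where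
  "couplings \<mu> \<nu> = {\<pi>. sets \<pi> = sets borel \<and> prob_space \<pi> \<and>
     distr \<pi> borel fst = \<mu> \<and> distr \<pi> borel snd = \<nu>}"

text \<open>On measures of compact support the infimum is finite, because the cost is bounded on
  the product of the supports. There \<open>enn2real\<close> loses no information.\<close>

definition Wasserstein :: "real \<Rightarrow> (real ^ 'n) measure \<Rightarrow> (real ^ 'n) measure \<Rightarrow> real" where
  "Wasserstein p \<mu> \<nu> =
     enn2real (INF \<pi>\<in>couplings \<mu> \<nu>. \<integral>\<^sup>+(x, y). ennreal (norm (x - y) powr p) \<partial>\<pi>) powr (1 / p)"

abbreviation mass_times :: "real \<Rightarrow> 'a measure \<Rightarrow> 'a measure" where
  "mass_times m \<mu> \<equiv> scale_measure (ennreal m) \<mu>"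

abbreviation dirac :: "real ^ 'n \<Rightarrow> (real ^ 'n) measure" where
  "dirac x \<equiv> return borel x"

abbreviation zero_measure :: "(real ^ 'n) measure" where
  "zero_measure \<equiv> null_measure borel"

end

theory Submission
  imports Defs
begin

text \<open>On Dirac masses the Wasserstein distance is the Euclidean distance, so the triangle
  inequality bounds $|f(m_0) - f(m)|\,|x - y|$ by $2C$ for all $x, y \in \Sigma$ and $m$ near
  $m_0$. Since $\Sigma$ is unbounded, $f$ is locally constant, hence constant. In case (a) the
  triangle inequality through $0$ bounds $f(m_0)\,|x - y|$ on $\Sigma$; in case (b) it
  yields $f(1)\,W_p(\mu_1, \mu_2) = 0$.\<close>

lemma measure_support_return:
  fixes x :: "'a::t1_space"
  shows "measure_support (return borel x) = {x}"
proof -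
  have "y = x" if "y \<in> measure_support (return borel x)" for y
  proof (rule ccontr)
    assume "y \<noteq> x"
    then have "0 < emeasure (return borel x) (- {x})"
      using that by (auto simp: measure_support_def open_Compl)
    then show False by simp
  qed
  then show ?thesis by (auto simp: measure_support_def)
qed

lemma measure_support_mass_times:
  assumes "0 < m"
  shows "measure_support (mass_times m \<mu>) = measure_support \<mu>"
  using assms by (auto simp: measure_support_def ennreal_zero_less_mult_iff)

lemma measure_support_null [simp]: "measure_support (null_measure M) = {}"
  unfolding measure_support_def by (auto intro!: exI[of _ UNIV])

lemma dirac_in_Pc: "dirac x \<in> Pc"
  by (simp add: Pc_def prob_space_return measure_support_return)

text \<open>The empty support is compact. This makes the zero measure an admissible middle point for
  the triangle inequality of an extended metric.\<close>

lemma zero_measure_in_Mc: "zero_measure \<in> Mc"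
  by (auto simp: Mc_def intro!: finite_measureI)

lemma mass_times_in_Mc_pos:
  assumes "\<mu> \<in> Pc" "0 < m"
  shows "mass_times m \<mu> \<in> Mc_pos"
proof -
  interpret prob_space \<mu> using assms by (simp add: Pc_def)
  have "emeasure (mass_times m \<mu>) (space \<mu>) = ennreal m"
    by (simp add: emeasure_space_1)
  then show ?thesis
    using assms
    by (auto simp: Mc_pos_def Mc_def Pc_def measure_support_mass_times space_scale_measure
        measure_def intro!: finite_measureI)
qed

text \<open>Each marginal sits at a single point, so each coordinate is almost surely constant. A
  transport plan between two Dirac masses therefore has no freedom, and every plan has the same
  cost.\<close>

lemma AE_coupling_dirac:
  assumes "\<pi> \<in> couplings (dirac x) (dirac y)"
  shows "AE z in \<pi>. z = (x, y)"
proof -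
  have sets: "sets \<pi> = sets borel"
    and dist: "distr \<pi> borel fst = dirac x" "distr \<pi> borel snd = dirac y"
    using assms by (auto simp: couplings_def)
  have meas: "fst \<in> \<pi> \<rightarrow>\<^sub>M borel" "snd \<in> \<pi> \<rightarrow>\<^sub>M borel"
    unfolding measurable_cong_sets[OF sets refl]
    by (auto intro!: borel_measurable_continuous_onI continuous_intros)
  have "AE z in dirac x. z = x" "AE z in dirac y. z = y"
    by (simp_all add: AE_return)
  then have "AE z in \<pi>. fst z = x" "AE z in \<pi>. snd z = y"
    unfolding dist[symmetric] by (simp_all add: AE_distr_iff meas)
  then show ?thesis
    by eventually_elim (auto simp: prod_eq_iff)
qed

lemma Wasserstein_dirac:
  fixes x y :: "real ^ 'n"
  assumes "p \<noteq> 0"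
  shows "Wasserstein p (dirac x) (dirac y) = norm (x - y)"
proof -
  let ?c = "\<lambda>(x, y). ennreal (norm (x - y) powr p)"
  have cost: "(\<integral>\<^sup>+z. ?c z \<partial>\<pi>) = ennreal (norm (x - y) powr p)"
    if "\<pi> \<in> couplings (dirac x) (dirac y)" for \<pi>
  proof -
    interpret prob_space \<pi> using that by (simp add: couplings_def)
    have "(\<integral>\<^sup>+z. ?c z \<partial>\<pi>) = (\<integral>\<^sup>+z. ennreal (norm (x - y) powr p) \<partial>\<pi>)"
      using AE_coupling_dirac[OF that] by (intro nn_integral_cong_AE) auto
    then show ?thesis by (simp add: emeasure_space_1)
  qed
  have meas: "fst \<in> (borel :: ((real ^ 'n) \<times> (real ^ 'n)) measure) \<rightarrow>\<^sub>M borel"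
    "snd \<in> (borel :: ((real ^ 'n) \<times> (real ^ 'n)) measure) \<rightarrow>\<^sub>M borel"
    by (auto intro!: borel_measurable_continuous_onI continuous_intros)
  \<comment> \<open>All plans cost the same, but an infimum over the empty set would be \<infinity>
    in \<open>ennreal\<close>; the Dirac mass at the pair shows that a plan exists.\<close>
  have "return borel (x, y) \<in> couplings (dirac x) (dirac y)"
    using meas by (simp add: couplings_def prob_space_return distr_return)
  then have "couplings (dirac x) (dirac y) \<noteq> {}" by blast
  then have "(INF \<pi>\<in>couplings (dirac x) (dirac y). \<integral>\<^sup>+z. ?c z \<partial>\<pi>)
      = ennreal (norm (x - y) powr p)"
    using cost by (rule INF_eq_const)
  then show ?thesis
    using assms by (simp add: Wasserstein_def powr_powr)
qed

lemma unbounded_dist_gt: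
  fixes S :: "'a::metric_space set"
  assumes "\<not> bounded S"
  shows "\<exists>x\<in>S. \<exists>y\<in>S. B < dist x y"
proof (rule ccontr)
  assume "\<not> ?thesis"
  then have "\<forall>x\<in>S. \<forall>y\<in>S. dist x y \<le> B" by force
  then have "bounded S" by (auto simp: bounded_two_points)
  with assms show False ..
qed

text \<open>A positive slope times arbitrarily large distances would exceed any bound. This is how
  the unboundedness of \<open>\<Sigma>\<close> is exploited: the slope will be a difference of two
  values of \<open>f\<close>, or a value of \<open>f\<close> itself.\<close>

lemma mult_dist_bounded_imp_nonpos:
  fixes S :: "'a::metric_space set" and a :: real
  assumes "\<not> bounded S" and bound: "\<And>x y. x \<in> S \<Longrightarrow> y \<in> S \<Longrightarrow> a * dist x y \<le> B"
  shows "a \<le> 0"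
proof (rule ccontr)
  assume "\<not> a \<le> 0"
  moreover obtain x y where "x \<in> S" "y \<in> S" "B / a < dist x y"
    using unbounded_dist_gt[OF assms(1)] by blast
  ultimately show False
    using bound[of x y] by (simp add: field_simps)
qed

theorem corollary1p2:
  fixes p :: real
    and d :: "(real ^ 'n) measure \<Rightarrow> (real ^ 'n) measure \<Rightarrow> real"
    and \<Sigma> :: "(real ^ 'n) set"
  assumes "1 \<le> p"
    and "Metric_space Mc_pos d"
    and "\<exists>f :: real \<Rightarrow> real. (\<forall>m>0. f m > 0) \<and>
           (\<forall>m>0. \<forall>\<mu>1\<in>Pc. \<forall>\<mu>2\<in>Pc.
              d (mass_times m \<mu>1) (mass_times m \<mu>2) = f m * Wasserstein p \<mu>1 \<mu>2)"
    and "\<not> bounded \<Sigma>"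
    and "\<forall>m\<^sub>0>0. \<exists>r>0. \<exists>C>0. \<forall>m. m\<^sub>0 - r < m \<and> m < m\<^sub>0 + r \<and> 0 < m \<longrightarrow>
           (SUP x\<in>\<Sigma>. ereal (d (mass_times m\<^sub>0 (dirac x)) (mass_times m (dirac x)))) \<le> ereal C"
  shows "\<not> (\<exists>d\<^sub>0. Metric_space Mc d\<^sub>0 \<and>
           (\<forall>\<mu>\<in>Mc_pos. \<forall>\<nu>\<in>Mc_pos. d\<^sub>0 \<mu> \<nu> = d \<mu> \<nu>) \<and>
           ((\<exists>m\<^sub>0>0. (SUP x\<in>\<Sigma>. ereal (d\<^sub>0 zero_measure (mass_times m\<^sub>0 (dirac x)))) < \<infinity>) \<or>
            (\<exists>\<mu>1\<in>Pc. \<exists>\<mu>2\<in>Pc. \<mu>1 \<noteq> \<mu>2 \<and>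
               ((\<lambda>m. d\<^sub>0 zero_measure (mass_times m \<mu>1)) \<longlongrightarrow> 0) (at_right 0) \<and>
               ((\<lambda>m. d\<^sub>0 zero_measure (mass_times m \<mu>2)) \<longlongrightarrow> 0) (at_right 0))))"
proof (rule notI, elim exE conjE)
  fix d\<^sub>0
  assume "Metric_space Mc d\<^sub>0"
    and agree: "\<forall>\<mu>\<in>Mc_pos. \<forall>\<nu>\<in>Mc_pos. d\<^sub>0 \<mu> \<nu> = d \<mu> \<nu>"
    and disj: "(\<exists>m\<^sub>0>0. (SUP x\<in>\<Sigma>. ereal (d\<^sub>0 zero_measure (mass_times m\<^sub>0 (dirac x)))) < \<infinity>) \<or>
            (\<exists>\<mu>1\<in>Pc. \<exists>\<mu>2\<in>Pc. \<mu>1 \<noteq> \<mu>2 \<and>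
               ((\<lambda>m. d\<^sub>0 zero_measure (mass_times m \<mu>1)) \<longlongrightarrow> 0) (at_right 0) \<and>
               ((\<lambda>m. d\<^sub>0 zero_measure (mass_times m \<mu>2)) \<longlongrightarrow> 0) (at_right 0))"
  interpret d: Metric_space Mc_pos d by fact
  interpret d\<^sub>0: Metric_space Mc d\<^sub>0 by fact
  obtain f :: "real \<Rightarrow> real" where f_pos: "\<And>m. 0 < m \<Longrightarrow> 0 < f m"
    and f: "\<And>m \<mu>1 \<mu>2. \<lbrakk>0 < m; \<mu>1 \<in> Pc; \<mu>2 \<in> Pc\<rbrakk> \<Longrightarrow>
              d (mass_times m \<mu>1) (mass_times m \<mu>2) = f m * Wasserstein p \<mu>1 \<mu>2"
    using assms(3) by metis
  have f_dirac: "d (mass_times m (dirac x)) (mass_times m (dirac y)) = f m * dist x y"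
    if "0 < m" for m x y
    using f[OF that dirac_in_Pc dirac_in_Pc] Wasserstein_dirac[of p x y] assms(1)
    by (simp add: dist_norm)
  \<comment> \<open>Travel from \<open>x\<close> to \<open>y\<close> at mass \<open>a\<close> by a
    detour: change the mass to \<open>b\<close> at \<open>x\<close>, move at mass \<open>b\<close>,
    change the mass back at \<open>y\<close>. The two changes of mass cost at most \<open>C\<close>
    each, however far apart \<open>x\<close> and \<open>y\<close> are.\<close>
  have f_close: "f a * dist x y \<le> f b * dist x y + 2 * C"
    if "0 < a" "0 < b"
      "d (mass_times a (dirac x)) (mass_times b (dirac x)) \<le> C"
      "d (mass_times a (dirac y)) (mass_times b (dirac y)) \<le> C" for a b C x y
  proof -
    let ?ax = "mass_times a (dirac x)" and ?ay = "mass_times a (dirac y)"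
    let ?bx = "mass_times b (dirac x)" and ?by = "mass_times b (dirac y)"
    have mem: "?ax \<in> Mc_pos" "?ay \<in> Mc_pos" "?bx \<in> Mc_pos" "?by \<in> Mc_pos"
      using that by (auto intro: mass_times_in_Mc_pos dirac_in_Pc)
    have "d ?ax ?ay \<le> d ?ax ?bx + d ?bx ?ay" "d ?bx ?ay \<le> d ?bx ?by + d ?by ?ay"
      using mem by (auto intro: d.triangle)
    then show ?thesis
      using that f_dirac[OF that(1), of x y] f_dirac[OF that(2), of x y] d.commute[of ?by ?ay]
      by linarith
  qed
  \<comment> \<open>The half-line of positive masses is connected, so local constancy
    suffices.\<close>
  have f_const: "f a = f b" if "0 < a" "0 < b" for a b
  proof (rule connected_local_const[where A = "{0<..}" and f = f])
    show "\<forall>a\<in>{0<..}. eventually (\<lambda>b. f a = f b) (at a within {0<..})"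
    proof
      fix a :: real assume "a \<in> {0<..}"
      then have a: "0 < a" by simp
      then obtain r C where "0 < r" and SUP_le: "\<forall>m. a - r < m \<and> m < a + r \<and> 0 < m \<longrightarrow>
          (SUP x\<in>\<Sigma>. ereal (d (mass_times a (dirac x)) (mass_times m (dirac x)))) \<le> ereal C"
        using assms(5)[rule_format, OF a] by blast
      have "f a = f m" if m: "a - r < m" "m < a + r" "0 < m" for m
      proof -
        have le: "d (mass_times a (dirac x)) (mass_times m (dirac x)) \<le> C" if "x \<in> \<Sigma>" for x
          using SUP_le[rule_format, of m] m that by (auto simp: SUP_le_iff)
        then have ge: "d (mass_times m (dirac x)) (mass_times a (dirac x)) \<le> C" if "x \<in> \<Sigma>" for x
          using that by (simp add: d.commute)
        \<comment> \<open>The detour estimate is used with the roles of the masses \<open>a\<close>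
          and \<open>m\<close> exchanged as well. Since \<open>C\<close> is uniform over
          \<open>\<Sigma>\<close>, neither difference can be positive.\<close>
        have "(f a - f m) * dist x y \<le> 2 * C" "(f m - f a) * dist x y \<le> 2 * C"
          if "x \<in> \<Sigma>" "y \<in> \<Sigma>" for x y
          using f_close[OF a m(3) le le, of x y] f_close[OF m(3) a ge ge, of x y] that
          by (simp_all add: algebra_simps)
        then have "f a - f m \<le> 0" "f m - f a \<le> 0"
          using mult_dist_bounded_imp_nonpos[OF assms(4)] by blast+
        then show ?thesis by simp
      qed
      then show "eventually (\<lambda>b. f a = f b) (at a within {0<..})"
        using \<open>0 < r\<close>
        by (auto simp: eventually_at dist_real_def abs_less_iff intro!: exI[of _ r])
    qed
  qed (use that in simp_all)
  have via_zero: "f m * Wasserstein p \<mu>1 \<mu>2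
      \<le> d\<^sub>0 zero_measure (mass_times m \<mu>1) + d\<^sub>0 zero_measure (mass_times m \<mu>2)"
    if "0 < m" "\<mu>1 \<in> Pc" "\<mu>2 \<in> Pc" for m \<mu>1 \<mu>2
  proof -
    have mem: "mass_times m \<mu>1 \<in> Mc_pos" "mass_times m \<mu>2 \<in> Mc_pos"
      using that by (auto intro: mass_times_in_Mc_pos)
    then have "mass_times m \<mu>1 \<in> Mc" "mass_times m \<mu>2 \<in> Mc"
      by (auto simp: Mc_pos_def)
    then have "d\<^sub>0 (mass_times m \<mu>1) (mass_times m \<mu>2)
        \<le> d\<^sub>0 zero_measure (mass_times m \<mu>1) + d\<^sub>0 zero_measure (mass_times m \<mu>2)"
      using d\<^sub>0.triangle[OF _ zero_measure_in_Mc] by (metis d\<^sub>0.commute)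
    then show ?thesis
      using f[OF that] agree mem by simp
  qed
  from disj show False
  proof (elim disjE exE bexE conjE)
    fix m\<^sub>0 :: real
    assume m\<^sub>0: "0 < m\<^sub>0"
      and "(SUP x\<in>\<Sigma>. ereal (d\<^sub>0 zero_measure (mass_times m\<^sub>0 (dirac x)))) < \<infinity>"
    \<comment> \<open>A real number strictly between the supremum and \<infinity> serves as a
      uniform bound in ordinary real arithmetic.\<close>
    then obtain K :: real
      where K: "(SUP x\<in>\<Sigma>. ereal (d\<^sub>0 zero_measure (mass_times m\<^sub>0 (dirac x)))) < ereal K"
      using ereal_dense2 by blast
    have "d\<^sub>0 zero_measure (mass_times m\<^sub>0 (dirac x)) \<le> K" if "x \<in> \<Sigma>" for x
      using less_imp_le[OF K] that by (auto simp: SUP_le_iff)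
    \<comment> \<open>\<open>f\<close> and \<open>f_dirac\<close> evaluate the same distance, which
      turns the Wasserstein term of \<open>via_zero\<close> into \<open>dist x y\<close>.\<close>
    then have "f m\<^sub>0 * dist x y \<le> 2 * K" if "x \<in> \<Sigma>" "y \<in> \<Sigma>" for x y
      using via_zero[OF m\<^sub>0 dirac_in_Pc dirac_in_Pc, of x y] that
        f[OF m\<^sub>0 dirac_in_Pc dirac_in_Pc, of x y] f_dirac[OF m\<^sub>0, of x y]
      by (smt (verit))
    then show False
      using mult_dist_bounded_imp_nonpos[OF assms(4)] f_pos[OF m\<^sub>0] by fastforce
  next
    fix \<mu>1 \<mu>2 :: "(real ^ 'n) measure"
    assume Pc: "\<mu>1 \<in> Pc" "\<mu>2 \<in> Pc" and "\<mu>1 \<noteq> \<mu>2"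
      and lim: "((\<lambda>m. d\<^sub>0 zero_measure (mass_times m \<mu>1)) \<longlongrightarrow> 0) (at_right 0)"
        "((\<lambda>m. d\<^sub>0 zero_measure (mass_times m \<mu>2)) \<longlongrightarrow> 0) (at_right 0)"
    \<comment> \<open>Constancy replaces \<open>f m\<close> by \<open>f 1\<close>, so the left side
      no longer depends on \<open>m\<close> and survives the limit; otherwise \<open>f m\<close>
      might tend to 0 with the mass.\<close>
    have "eventually (\<lambda>m. f 1 * Wasserstein p \<mu>1 \<mu>2
        \<le> d\<^sub>0 zero_measure (mass_times m \<mu>1) + d\<^sub>0 zero_measure (mass_times m \<mu>2)) (at_right 0)"
      using eventually_at_right_less[of 0]
    proof eventually_elim
      case (elim m)
      then show ?case using via_zero[OF elim Pc] f_const[of m 1] by simp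
    qed
    from tendsto_lowerbound[OF tendsto_add[OF lim] this]
    have "f 1 * Wasserstein p \<mu>1 \<mu>2 \<le> 0" by simp
    \<comment> \<open>At mass 1 scaling is the identity, so the bound on the Wasserstein term
      becomes one on \<open>d \<mu>1 \<mu>2\<close>. The contradiction then comes from
      \<open>d\<close> separating points.\<close>
    moreover have one: "mass_times 1 \<mu> = \<mu>" for \<mu> :: "(real ^ 'n) measure"
      by simp
    ultimately have "d \<mu>1 \<mu>2 \<le> 0"
      using f[of 1, OF _ Pc] by simp
    moreover have "\<mu>1 \<in> Mc_pos" "\<mu>2 \<in> Mc_pos"
      using mass_times_in_Mc_pos[of _ 1] Pc unfolding one by auto
    ultimately show False
      using d.nonneg[of \<mu>1 \<mu>2] \<open>\<mu>1 \<noteq> \<mu>2\<close> by (metis d.zero order_antisym)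
  qed
qed

end
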